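(* Let $\Omega$ be a closed Jordan domain contained in the open rectangle $\mathbf{R}=\{(x,y)\mid a<x<b,\ c<y<d\}$, and let $f(x,y)$ be a function integrable in $\Omega$. Suppose that the set of points of discontinuity of $f$ has zero Jordan measure, and suppose moreover that this set is closed. Then the double integral of $f$ over $\Omega$ can be written as the repeated integral $$\int_\Omega f(x,y)\,dx\,dy=\int_a^b\left(\int_{\Omega_x}f(x,y)\,dy\right)dx,$$ where the inner integral with respect to $y$ is taken in the improper sense, as the limit of the integrals over the sets $\Omega_{x,\varepsilon_n}$ defined in the context, $$\int_{\Omega_x}f(x,y)\,dy=\lim_{n\to\infty}\int_{\Omega_{x,\varepsilon_n}}f(x,y)\,dy,$$ and represents a function of $x$ that is integrable on $[a,b]$ in the Riemann sense.
   Context: Integrable means Riemann integrable (in particular, $f$ is bounded). A closed Jordan domain is a bounded closed set in $\mathbb{R}^2$ whose boundary has zero Jordan measure. A set has zero Jordan measure if for every $\varepsilon>0$ it can be covered by finitely many squares with sides parallel to the coordinate axes and total area less than $\varepsilon$. Let $\varepsilon_1>\varepsilon_2>\cdots$ be a decreasing sequence of positive numbers with $\varepsilon_n\to0$. For each $\varepsilon=\varepsilon_n$, let $\Delta_\varepsilon$ be the union of a finite family of open squares with sides parallel to the axes and total area less than $\varepsilon$, no square of the family being contained in another one, such that $\Delta_\varepsilon$ contains all points of discontinuity of $f$ and the boundary $\partial\Omega$. The coverings are chosen nested: $\Delta_{\varepsilon_{n+1}}\subset\Delta_{\varepsilon_n}$. For $x\in[a,b]$ put $$\Omega_{x,\varepsilon_n}=\{y\mid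 (x,y)\in\Omega\setminus\Delta_{\varepsilon_n}\},\qquad \Omega_x=\bigcup_n\Omega_{x,\varepsilon_n}.$$ The sets $\Omega_{x,\varepsilon_n}$ increase with $n$, and an integral over an empty set is $0$. *)

theory Defs
  imports "HOL-Analysis.Analysis"
begin

text \<open>Riemann integral as a limit of Riemann sums as the mesh tends to zero. Unlike for the
  Henstock--Kurzweil integral \<^const>\<open>has_integral\<close>, the fineness \<open>d\<close> must not depend on the tags.\<close>

definition has_riemann_integral_cbox ::
    "('a::euclidean_space \<Rightarrow> real) \<Rightarrow> real \<Rightarrow> 'a \<Rightarrow> 'a \<Rightarrow> bool" where
  "has_riemann_integral_cbox f I a b \<longleftrightarrow>
     (\<forall>e>0. \<exists>d>0. \<forall>p. p tagged_division_of (cbox a b) \<and> (\<forall>(x, K)\<in>p. diameter K < d) \<longrightarrow>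
        \<bar>(\<Sum>(x, K)\<in>p. measure lborel K * f x) - I\<bar> < e)"

text \<open>Over a general bounded set, the function is extended by zero to a box. The box is required
  to be nondegenerate, since every function, bounded or not, has integral zero over a degenerate
  one.\<close>

definition has_riemann_integral ::
    "('a::euclidean_space \<Rightarrow> real) \<Rightarrow> real \<Rightarrow> 'a set \<Rightarrow> bool"
    (infixr \<open>has'_riemann'_integral\<close> 46) where
  "(f has_riemann_integral I) S \<longleftrightarrow>
     (\<exists>a b. box a b \<noteq> {} \<and> S \<subseteq> cbox a b \<and>
        has_riemann_integral_cbox (\<lambda>x. if x \<in> S then f x else 0) I a b)"

definition riemann_integrable_on ::
    "('a::euclidean_space \<Rightarrow> real) \<Rightarrow> 'a set \<Rightarrow> bool"
    (infixr \<open>riemann'_integrable'_on\<close> 46) where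
  "f riemann_integrable_on S \<longleftrightarrow> (\<exists>I. (f has_riemann_integral I) S)"

definition riemann_integral :: "'a::euclidean_space set \<Rightarrow> ('a \<Rightarrow> real) \<Rightarrow> real" where
  "riemann_integral S f = (THE I. (f has_riemann_integral I) S)"

lemma has_riemann_integral_imp_has_integral:
  assumes "(f has_riemann_integral I) S"
  shows "(f has_integral I) S"
proof -
  let ?g = "\<lambda>x. if x \<in> S then f x else 0"
  obtain a b where sub: "S \<subseteq> cbox a b" and R: "has_riemann_integral_cbox ?g I a b"
    using assms unfolding has_riemann_integral_def by blast
  have "(?g has_integral I) (cbox a b)"
    unfolding has_integral
  proof (intro allI impI)
    fix e :: real assume "e > 0"
    then obtain d where "d > 0" and
      d: "\<And>p. p tagged_division_of (cbox a b) \<Longrightarrow> (\<forall>(x, K)\<in>p. diameter K < d) \<Longrightarrow>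
            \<bar>(\<Sum>(x, K)\<in>p. measure lborel K * ?g x) - I\<bar> < e"
      using R unfolding has_riemann_integral_cbox_def by meson
    have "gauge (\<lambda>x. ball x (d/3))"
      using \<open>d > 0\<close> by (auto simp: gauge_def)
    moreover have "norm ((\<Sum>(x, K)\<in>p. measure lborel K *\<^sub>R ?g x) - I) < e"
      if "p tagged_division_of cbox a b" and fine: "(\<lambda>x. ball x (d/3)) fine p" for p
    proof -
      have "diameter K < d" if "(x, K) \<in> p" for x K
      proof -
        have "K \<subseteq> ball x (d/3)" using fine that by (auto simp: fine_def)
        then have "diameter K \<le> diameter (ball x (d/3))"
          by (intro diameter_subset) auto
        then show ?thesis using \<open>d > 0\<close> by (simp add: diameter_ball)
      qed
      then have "\<forall>(x, K)\<in>p. diameter K < d" by blast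
      from d[OF that(1) this] show ?thesis by (simp only: real_norm_def real_scaleR_def)
    qed
    ultimately show "\<exists>\<gamma>. gauge \<gamma> \<and> (\<forall>\<D>. \<D> tagged_division_of cbox a b \<and> \<gamma> fine \<D> \<longrightarrow>
        norm ((\<Sum>(x, K)\<in>\<D>. measure lborel K *\<^sub>R ?g x) - I) < e)"
      by (intro exI[of _ "\<lambda>x. ball x (d/3)"] conjI allI impI) simp_all
  qed
  then show ?thesis
    by (simp add: has_integral_restrict[OF sub])
qed

lemma riemann_integral_unique:
  "(f has_riemann_integral I) S \<Longrightarrow> riemann_integral S f = I"
  unfolding riemann_integral_def
  by (rule the_equality)
    (auto dest: has_riemann_integral_imp_has_integral has_integral_unique)

text \<open>Improper integral over \<open>S\<close> along a given exhaustion \<open>T\<close> of \<open>S\<close>.\<close>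

definition has_improper_integral_along ::
    "(real \<Rightarrow> real) \<Rightarrow> (nat \<Rightarrow> real set) \<Rightarrow> real set \<Rightarrow> real \<Rightarrow> bool" where
  "has_improper_integral_along f T S I \<longleftrightarrow>
     incseq T \<and> S = (\<Union>n. T n) \<and> (\<forall>n. f riemann_integrable_on T n) \<and>
     (\<lambda>n. riemann_integral (T n) f) \<longlonglongrightarrow> I"

definition open_square :: "(real \<times> real) set \<Rightarrow> bool" where
  "open_square Q \<longleftrightarrow> (\<exists>u v s. s > 0 \<and> Q = {u<..<u + s} \<times> {v<..<v + s})"

text \<open>Covers by open or by closed squares give the same null sets.\<close>

definition zero_jordan_measure :: "(real \<times> real) set \<Rightarrow> bool" where
  "zero_jordan_measure A \<longleftrightarrow>
     (\<forall>e>0. \<exists>F. finite F \<and> (\<forall>Q\<in>F. open_square Q) \<and> A \<subseteq> \<Union>F \<and> (\<Sum>Q\<in>F. measure lborel Q) < e)"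

definition closed_jordan_domain :: "(real \<times> real) set \<Rightarrow> bool" where
  "closed_jordan_domain \<Omega> \<longleftrightarrow> bounded \<Omega> \<and> closed \<Omega> \<and> zero_jordan_measure (frontier \<Omega>)"

text \<open>Only the values on \<open>\<Omega>\<close> matter: \<open>f\<close> is a function on \<open>\<Omega>\<close>, encoded as a total function.\<close>

definition discontinuities :: "(real \<times> real) set \<Rightarrow> (real \<times> real \<Rightarrow> real) \<Rightarrow> (real \<times> real) set" where
  "discontinuities \<Omega> f = {z \<in> \<Omega>. \<not> continuous (at z within \<Omega>) f}"

definition admissible_squares ::
    "(real \<times> real) set \<Rightarrow> (real \<times> real \<Rightarrow> real) \<Rightarrow> real \<Rightarrow> (real \<times> real) set set \<Rightarrow> bool" where
  "admissible_squares \<Omega> f e F \<longleftrightarrow>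
     finite F \<and> (\<forall>Q\<in>F. open_square Q) \<and> (\<Sum>Q\<in>F. measure lborel Q) < e \<and>
     (\<forall>Q\<in>F. \<forall>Q'\<in>F. Q \<subseteq> Q' \<longrightarrow> Q = Q') \<and>
     discontinuities \<Omega> f \<union> frontier \<Omega> \<subseteq> \<Union>F"

definition section_minus ::
    "(real \<times> real) set \<Rightarrow> (real \<times> real) set \<Rightarrow> real \<Rightarrow> real set" where
  "section_minus \<Omega> \<Delta> x = {y. (x, y) \<in> \<Omega> - \<Delta>}"

end

theory Submission
  imports Defs
begin

text \<open>Let \<open>\<bar>f\<bar> \<le> M\<close> on \<open>\<Omega>\<close>. Off \<open>\<Delta>\<^sub>n\<close>, the extension of \<open>f\<close> by zero is continuous, so Tietze gives a
  continuous \<open>\<phi>\<^sub>n\<close> on the plane that agrees with it there and is bounded by \<open>M\<close>. Let \<open>G\<^sub>n x\<close> be the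
  integral of \<open>\<phi>\<^sub>n(x, \<cdot>)\<close> over \<open>[c, d]\<close>, a continuous function of \<open>x\<close>. The inner integrals over
  \<open>\<Omega>\<^bsub>x,m\<^esub>\<close>, \<open>m \<ge> n\<close>, and hence their limit \<open>g x\<close>, differ from \<open>G\<^sub>n x\<close> by at most \<open>2M\<close> times the length
  of the section of \<open>\<Delta>\<^sub>n\<close> at \<open>x\<close>. That length is at most \<open>w\<^sub>n x\<close>, a sum of continuous tent functions with
  integral at most \<open>2\<epsilon>\<^sub>n\<close>. A function that can be approximated by a continuous one up to a continuous
  error of arbitrarily small integral is Riemann integrable, so \<open>g\<close> is. Fubini for \<open>\<phi>\<^sub>n\<close> finally bounds the
  difference of the double and the repeated integral by \<open>6M\<epsilon>\<^sub>n\<close>.\<close>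

section \<open>Riemann integrability by continuous approximation\<close>

lemma uniform_tagged_division_exists:
  fixes a b :: "'a::euclidean_space"
  assumes "d > 0"
  obtains p where "p tagged_division_of cbox a b" "\<forall>(x, K)\<in>p. diameter K < d"
proof -
  \<comment> \<open>A constant gauge turns fineness into a mesh bound: a ball of radius
    \<open>d/3\<close> has diameter \<open>2*d/3\<close>, which is less than
    \<open>d\<close>.\<close>
  have "gauge (\<lambda>x::'a. ball x (d/3))" using assms by (auto simp: gauge_def)
  then obtain p where p: "p tagged_division_of cbox a b" "(\<lambda>x. ball x (d/3)) fine p"
    by (rule fine_division_exists)
  have "diameter K < d" if "(x, K) \<in> p" for x K
  proof -
    have "K \<subseteq> ball x (d/3)" using p(2) that by (auto simp: fine_def)
    then have "diameter K \<le> diameter (ball x (d/3))" by (intro diameter_subset) auto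
    then show ?thesis using assms by (simp add: diameter_ball)
  qed
  with p(1) show thesis by (intro that[of p]) auto
qed

text \<open>Fix one division of small mesh. Changing the tag of a single piece \<open>K\<close>
  keeps the mesh, so both sums stay within 1 of \<open>I\<close>, and their difference
  \<open>measure lborel K * (f x - f (t K))\<close> is at most 2 in absolute value. This bounds
  \<open>f\<close> on each of the finitely many pieces.\<close>

lemma has_riemann_integral_cbox_imp_bounded:
  fixes f :: "'a::euclidean_space \<Rightarrow> real"
  assumes R: "has_riemann_integral_cbox f I a b" and ne: "box a b \<noteq> {}"
  shows "bounded (f ` cbox a b)"
proof -
  obtain d where "d > 0" and
    d: "\<And>p. p tagged_division_of cbox a b \<Longrightarrow> \<forall>(x, K)\<in>p. diameter K < d \<Longrightarrow>
          \<bar>(\<Sum>(x, K)\<in>p. measure lborel K * f x) - I\<bar> < 1"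
    using R unfolding has_riemann_integral_cbox_def by (meson zero_less_one)
  obtain p where p: "p tagged_division_of cbox a b" "\<forall>(x, K)\<in>p. diameter K < d"
    using uniform_tagged_division_exists[OF \<open>d > 0\<close>] .
  have c0: "measure lborel (cbox a b) \<noteq> 0"
    using ne by (simp add: content_eq_0_interior)
  \<comment> \<open>The estimate divides by the content of a piece, so null pieces are discarded.
    The others still cover the box because the box itself has nonzero content.\<close>
  define D where "D = {K \<in> snd ` p. measure lborel K \<noteq> 0}"
  have D: "D division_of cbox a b"
    unfolding D_def by (intro division_of_nontrivial division_of_tagged_division p c0)
  note Dd = division_ofD[OF D]
  define t where "t K = (SOME x. x \<in> K)" for K :: "'a set"
  have t: "t K \<in> K" if "K \<in> D" for K
    using Dd(3)[OF that] by (auto simp: t_def some_in_eq)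
  define S where "S \<tau> = (\<Sum>K\<in>D. measure lborel K * f (\<tau> K))" for \<tau>
  have S: "\<bar>S \<tau> - I\<bar> < 1" if \<tau>: "\<And>K. K \<in> D \<Longrightarrow> \<tau> K \<in> K" for \<tau>
  proof -
    let ?q = "(\<lambda>K. (\<tau> K, K)) ` D"
    have "?q tagged_division_of cbox a b"
    proof (rule tagged_division_ofI)
      show "finite ?q" using Dd(1) by simp
      show "\<Union>{K. \<exists>x. (x, K) \<in> ?q} = cbox a b" using Dd(6) by (auto simp: image_iff)
      show "interior K1 \<inter> interior K2 = {}"
        if "(x1, K1) \<in> ?q" "(x2, K2) \<in> ?q" "(x1, K1) \<noteq> (x2, K2)" for x1 K1 x2 K2
        using that Dd(5)[of K1 K2] by auto
    qed (use \<tau> Dd(2,4) in auto)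
    moreover have "\<forall>(x, K)\<in>?q. diameter K < d"
      using p(2) by (auto simp: D_def)
    ultimately have "\<bar>(\<Sum>(x, K)\<in>?q. measure lborel K * f x) - I\<bar> < 1"
      by (rule d)
    also have "(\<Sum>(x, K)\<in>?q. measure lborel K * f x) = S \<tau>"
      unfolding S_def by (subst sum.reindex) (auto simp: inj_on_def)
    finally show ?thesis .
  qed
  have "bounded (f ` K)" if K: "K \<in> D" for K
  proof -
    have cK: "measure lborel K > 0"
      using K by (simp add: D_def zero_less_measure_iff)
    have "\<bar>f x\<bar> \<le> \<bar>f (t K)\<bar> + 2 / measure lborel K" if x: "x \<in> K" for x
    proof -
      have "S (t(K := x)) - S t = measure lborel K * (f x - f (t K))"
        unfolding S_def
        by (subst (1 2) sum.remove[OF Dd(1) K]) (simp add: algebra_simps)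
      moreover have "\<bar>S (t(K := x)) - I\<bar> < 1" "\<bar>S t - I\<bar> < 1"
        using x t by (auto intro!: S)
      ultimately have "\<bar>measure lborel K * (f x - f (t K))\<bar> \<le> 2" by linarith
      then have "\<bar>f x - f (t K)\<bar> \<le> 2 / measure lborel K"
        using cK by (simp add: abs_mult pos_le_divide_eq mult.commute[of "measure lborel K"])
      then show ?thesis by linarith
    qed
    then show ?thesis by (auto simp: bounded_iff)
  qed
  then have "bounded (\<Union>K\<in>D. f ` K)" using Dd(1) by (intro bounded_UN) auto
  then show ?thesis using Dd(6) by (simp flip: image_Union)
qed

lemma riemann_integrable_imp_bounded:
  fixes f :: "'a::euclidean_space \<Rightarrow> real"
  assumes "f riemann_integrable_on S"
  shows "bounded (f ` S)"
proof -
  let ?g = "\<lambda>x. if x \<in> S then f x else 0"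
  obtain I a b where "box a b \<noteq> {}" "S \<subseteq> cbox a b" "has_riemann_integral_cbox ?g I a b"
    using assms unfolding riemann_integrable_on_def has_riemann_integral_def by blast
  then have "bounded (?g ` cbox a b)" "f ` S \<subseteq> ?g ` cbox a b"
    using has_riemann_integral_cbox_imp_bounded by (blast, force)
  then show ?thesis by (rule bounded_subset)
qed

text \<open>Uniform continuity supplies a mesh that does not depend on the tags; each summand then
  misses the integral over its piece by at most \<open>e'\<close> times the content.\<close>

lemma has_riemann_integral_cbox_continuous:
  fixes f :: "'a::euclidean_space \<Rightarrow> real"
  assumes cont: "continuous_on (cbox a b) f"
  shows "has_riemann_integral_cbox f (integral (cbox a b) f) a b"
  unfolding has_riemann_integral_cbox_def
proof (intro allI impI)
  fix e :: real assume "e > 0"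
  \<comment> \<open>Adding 1 covers boxes of content zero and makes the final estimate
    strict.\<close>
  define e' where "e' = e / (measure lborel (cbox a b) + 1)"
  have c0: "measure lborel (cbox a b) + 1 > 0" by (simp add: add_nonneg_pos)
  then have e': "e' > 0" using \<open>e > 0\<close> by (simp add: e'_def)
  have "uniformly_continuous_on (cbox a b) f"
    using cont compact_cbox by (rule compact_uniformly_continuous)
  then obtain d where "d > 0" and
    d: "\<And>x y. x \<in> cbox a b \<Longrightarrow> y \<in> cbox a b \<Longrightarrow> dist y x < d \<Longrightarrow> dist (f y) (f x) < e'"
    using e' unfolding uniformly_continuous_on_def by meson
  have int: "f integrable_on cbox a b" using cont by (rule integrable_continuous)
  have "\<bar>(\<Sum>(x, K)\<in>p. measure lborel K * f x) - integral (cbox a b) f\<bar> < e"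
    if p: "p tagged_division_of cbox a b" and fine: "\<forall>(x, K)\<in>p. diameter K < d" for p
  proof -
    note pD = tagged_division_ofD[OF p]
    have *: "\<bar>measure lborel K * f x - integral K f\<bar> \<le> e' * measure lborel K" if xK: "(x, K) \<in> p" for x K
    proof -
      obtain u v where K: "K = cbox u v" using pD(4)[OF xK] by blast
      have "f integrable_on K"
        using int integrable_on_subcbox pD(3)[OF xK] K by blast
      then have "((\<lambda>y. f x - f y) has_integral (measure lborel K * f x - integral K f)) (cbox u v)"
        unfolding K using has_integral_diff[OF has_integral_const[of "f x" u v] integrable_integral]
        by simp
      moreover have "norm (f x - f y) \<le> e'" if y: "y \<in> cbox u v" for y
      proof -
        have "dist x y \<le> diameter K"
          using pD(2)[OF xK] y K by (intro diameter_bounded_bound) auto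
        then have "dist x y < d" using fine xK by fastforce
        then show ?thesis
          using d[of y x] pD(2,3)[OF xK] y K by (fastforce simp: dist_norm)
      qed
      ultimately have "norm (measure lborel K * f x - integral K f) \<le> e' * measure lborel (cbox u v)"
        using e' by (intro has_integral_bound) auto
      then show ?thesis by (simp add: K)
    qed
    have "(\<Sum>(x, K)\<in>p. measure lborel K * f x) - integral (cbox a b) f =
        (\<Sum>(x, K)\<in>p. measure lborel K * f x - integral K f)"
      using integral_combine_tagged_division_topdown[OF int p]
      by (simp add: sum_subtractf split_def)
    also have "\<bar>\<dots>\<bar> \<le> (\<Sum>(x, K)\<in>p. e' * measure lborel K)"
      using * by (intro order_trans[OF sum_abs] sum_mono) auto
    also have "\<dots> = e' * measure lborel (cbox a b)"
      using additive_content_tagged_division[OF p] by (simp add: split_def flip: sum_distrib_left)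
    also have "\<dots> < e' * (measure lborel (cbox a b) + 1)" using e' by simp
    also have "\<dots> = e" using c0 by (simp add: e'_def)
    finally show ?thesis .
  qed
  then show "\<exists>d>0. \<forall>p. p tagged_division_of cbox a b \<and> (\<forall>(x, K)\<in>p. diameter K < d) \<longrightarrow>
      \<bar>(\<Sum>(x, K)\<in>p. measure lborel K * f x) - integral (cbox a b) f\<bar> < e"
    using \<open>d > 0\<close> by blast
qed

text \<open>Integrability in the gauge sense follows by squeezing \<open>g\<close> between
  \<open>G - h\<close> and \<open>G + h\<close>. For the uniform mesh, the sums of \<open>g\<close>
  and \<open>G\<close> differ by at most the sum of \<open>h\<close>, and the sums of the continuous
  \<open>G\<close> and \<open>h\<close> converge as the mesh shrinks.\<close>

lemma has_riemann_integral_cbox_approx: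
  fixes g :: "'a::euclidean_space \<Rightarrow> real"
  assumes "\<And>e. e > 0 \<Longrightarrow> \<exists>G h. continuous_on (cbox a b) G \<and> continuous_on (cbox a b) h \<and>
      (\<forall>x\<in>cbox a b. \<bar>g x - G x\<bar> \<le> h x) \<and> integral (cbox a b) h < e"
  shows "g integrable_on cbox a b"
    and "has_riemann_integral_cbox g (integral (cbox a b) g) a b"
proof -
  show int: "g integrable_on cbox a b"
  proof (rule integrable_straddle_interval)
    fix e :: real assume "e > 0"
    then obtain G h where
      Gh: "continuous_on (cbox a b) G" "continuous_on (cbox a b) h"
        "\<And>x. x \<in> cbox a b \<Longrightarrow> \<bar>g x - G x\<bar> \<le> h x" "integral (cbox a b) h < e / 2"
      using assms[of "e/2"] by auto
    have iG: "(G has_integral integral (cbox a b) G) (cbox a b)"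
      and ih: "(h has_integral integral (cbox a b) h) (cbox a b)"
      using Gh by (auto intro!: integrable_integral integrable_continuous)
    have "0 \<le> integral (cbox a b) h"
      using ih by (rule has_integral_nonneg) (use Gh(3) in force)
    then have "\<bar>(integral (cbox a b) G - integral (cbox a b) h) -
        (integral (cbox a b) G + integral (cbox a b) h)\<bar> < e"
      using Gh(4) by simp
    moreover have "G x - h x \<le> g x \<and> g x \<le> G x + h x" if "x \<in> cbox a b" for x
      using Gh(3)[OF that] by auto
    ultimately show "\<exists>u v i j. (u has_integral i) (cbox a b) \<and> (v has_integral j) (cbox a b) \<and>
        \<bar>i - j\<bar> < e \<and> (\<forall>x\<in>cbox a b. u x \<le> g x \<and> g x \<le> v x)"
      using has_integral_diff[OF iG ih] has_integral_add[OF iG ih] by blast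
  qed
  show "has_riemann_integral_cbox g (integral (cbox a b) g) a b"
    unfolding has_riemann_integral_cbox_def
  proof (intro allI impI)
    fix e :: real assume "e > 0"
    then obtain G h where
      Gh: "continuous_on (cbox a b) G" "continuous_on (cbox a b) h"
        "\<And>x. x \<in> cbox a b \<Longrightarrow> \<bar>g x - G x\<bar> \<le> h x" "integral (cbox a b) h < e / 4"
      using assms[of "e/4"] by auto
    have iG: "G integrable_on cbox a b" and ih: "h integrable_on cbox a b"
      using Gh by (auto intro!: integrable_continuous)
    have "norm (integral (cbox a b) (\<lambda>x. g x - G x)) \<le> integral (cbox a b) h"
      using Gh(3) by (intro integral_norm_bound_integral integrable_diff int iG ih) auto
    then have gG: "\<bar>integral (cbox a b) g - integral (cbox a b) G\<bar> \<le> integral (cbox a b) h"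
      by (simp add: integral_diff[OF int iG])
    have e4: "e/4 > 0" using \<open>e > 0\<close> by simp
    obtain d1 where d1: "d1 > 0"
      "\<And>p. p tagged_division_of cbox a b \<Longrightarrow> \<forall>(x, K)\<in>p. diameter K < d1 \<Longrightarrow>
        \<bar>(\<Sum>(x, K)\<in>p. measure lborel K * G x) - integral (cbox a b) G\<bar> < e/4"
      using has_riemann_integral_cbox_continuous[OF Gh(1)] e4
      unfolding has_riemann_integral_cbox_def by meson
    obtain d2 where d2: "d2 > 0"
      "\<And>p. p tagged_division_of cbox a b \<Longrightarrow> \<forall>(x, K)\<in>p. diameter K < d2 \<Longrightarrow>
        \<bar>(\<Sum>(x, K)\<in>p. measure lborel K * h x) - integral (cbox a b) h\<bar> < e/4"
      using has_riemann_integral_cbox_continuous[OF Gh(2)] e4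
      unfolding has_riemann_integral_cbox_def by meson
    have "\<bar>(\<Sum>(x, K)\<in>p. measure lborel K * g x) - integral (cbox a b) g\<bar> < e"
      if p: "p tagged_division_of cbox a b" and fine: "\<forall>(x, K)\<in>p. diameter K < min d1 d2" for p
    proof -
      note pD = tagged_division_ofD[OF p]
      have "\<bar>(\<Sum>(x, K)\<in>p. measure lborel K * g x) - (\<Sum>(x, K)\<in>p. measure lborel K * G x)\<bar> =
          \<bar>\<Sum>(x, K)\<in>p. measure lborel K * (g x - G x)\<bar>"
        by (simp add: sum_subtractf split_def right_diff_distrib)
      also have "\<dots> \<le> (\<Sum>(x, K)\<in>p. measure lborel K * h x)"
      proof (intro order_trans[OF sum_abs] sum_mono)
        fix z assume "z \<in> p"
        then have "\<bar>g (fst z) - G (fst z)\<bar> \<le> h (fst z)"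
          using pD(2)[of "fst z" "snd z"] pD(3)[of "fst z" "snd z"] by (intro Gh(3)) auto
        then show "\<bar>case z of (x, K) \<Rightarrow> measure lborel K * (g x - G x)\<bar> \<le>
            (case z of (x, K) \<Rightarrow> measure lborel K * h x)"
          by (cases z) (auto simp: abs_mult intro!: mult_left_mono)
      qed
      finally have "\<bar>(\<Sum>(x, K)\<in>p. measure lborel K * g x) - (\<Sum>(x, K)\<in>p. measure lborel K * G x)\<bar> \<le>
        (\<Sum>(x, K)\<in>p. measure lborel K * h x)" .
      moreover have "\<bar>(\<Sum>(x, K)\<in>p. measure lborel K * G x) - integral (cbox a b) G\<bar> < e/4"
        using fine by (intro d1(2) p) auto
      moreover have "\<bar>(\<Sum>(x, K)\<in>p. measure lborel K * h x) - integral (cbox a b) h\<bar> < e/4"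
        using fine by (intro d2(2) p) auto
      \<comment> \<open>The sum of \<open>h\<close> is below its integral plus \<open>e/4\<close>,
        hence below \<open>e/2\<close>; the sum of \<open>G\<close> and the integral of
        \<open>G\<close> contribute less than \<open>e/4\<close> each.\<close>
      ultimately show ?thesis using gG Gh(4) by linarith
    qed
    then show "\<exists>d>0. \<forall>p. p tagged_division_of cbox a b \<and> (\<forall>(x, K)\<in>p. diameter K < d) \<longrightarrow>
        \<bar>(\<Sum>(x, K)\<in>p. measure lborel K * g x) - integral (cbox a b) g\<bar> < e"
      using d1(1) d2(1) by (intro exI[of _ "min d1 d2"]) auto
  qed
qed

lemma has_riemann_integral_cbox_eq:
  fixes f :: "'a::euclidean_space \<Rightarrow> real"
  assumes "has_riemann_integral_cbox f I a b" and eq: "\<And>x. x \<in> cbox a b \<Longrightarrow> f x = g x"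
  shows "has_riemann_integral_cbox g I a b"
proof -
  have "(\<Sum>(x, K)\<in>p. measure lborel K * f x) = (\<Sum>(x, K)\<in>p. measure lborel K * g x)"
    if "p tagged_division_of cbox a b" for p
    using tag_in_interval[OF that] eq by (intro sum.cong) auto
  with assms(1) show ?thesis unfolding has_riemann_integral_cbox_def by metis
qed

section \<open>Indicators, tents and functions with finitely many discontinuities\<close>

lemma integral_indicator_cbox_le:
  fixes S :: "'a::euclidean_space set"
  assumes "S \<in> lmeasurable"
  shows "indicat_real S integrable_on cbox a b"
    and "integral (cbox a b) (indicat_real S) \<le> measure lebesgue S"
proof -
  have U: "(indicat_real S has_integral measure lebesgue S) UNIV"
    using assms lmeasurable_iff_has_integral by blast
  then show i: "indicat_real S integrable_on cbox a b"
    using integrable_on_subcbox by blast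
  have "integral (cbox a b) (indicat_real S) \<le> integral UNIV (indicat_real S)"
    using U i by (intro integral_subset_le) auto
  then show "integral (cbox a b) (indicat_real S) \<le> measure lebesgue S"
    using U by (simp add: integral_unique)
qed

text \<open>Equal to \<open>1\<close> on \<open>[u, u + s]\<close> and supported in \<open>[u - s/2, u + 3s/2]\<close>.\<close>

definition tent :: "real \<Rightarrow> real \<Rightarrow> real \<Rightarrow> real" where
  "tent u s x = max 0 (1 - 2 / s * infdist x {u..u + s})"

lemma continuous_on_tent: "continuous_on A (tent u s)"
  unfolding tent_def by (intro continuous_intros)

lemma tent_nonneg: "0 \<le> tent u s x"
  by (simp add: tent_def)

lemma indicator_le_tent: "indicat_real {u<..<u + s} x \<le> tent u s x"
  by (auto simp: tent_def indicator_def)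

text \<open>The tent is at most 1 and vanishes at distance \<open>s/2\<close> or more from its
  plateau of length \<open>s\<close>, so it lies below the indicator of an interval of length
  \<open>2*s\<close>.\<close>

lemma integral_tent_le:
  assumes "s > 0"
  shows "integral (cbox a b) (tent u s) \<le> 2 * s"
proof -
  have *: "tent u s x \<le> indicat_real (cbox (u - s/2) (u + 3 * s / 2)) x" for x
  proof (cases "x \<in> cbox (u - s/2) (u + 3 * s / 2)")
    case False
    have "infdist x {u..u + s} \<ge> s/2"
      using assms False by (auto intro!: cINF_greatest simp: infdist_def dist_real_def)
    then show ?thesis using assms False by (simp add: tent_def field_simps)
  qed (use assms in \<open>simp add: tent_def infdist_nonneg\<close>)
  have "integral (cbox a b) (tent u s) \<le>
      integral (cbox a b) (indicat_real (cbox (u - s/2) (u + 3 * s / 2)))"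
    by (intro integral_le integrable_continuous continuous_on_tent integral_indicator_cbox_le *) auto
  also have "\<dots> \<le> measure lebesgue (cbox (u - s/2) (u + 3 * s / 2))"
    by (intro integral_indicator_cbox_le) auto
  also have "\<dots> = 2 * s" using assms by simp
  finally show ?thesis .
qed

text \<open>Short intervals around the points of \<open>D\<close> are removed, Tietze extends the
  rest continuously, and tents over the removed intervals bound the error. This is what makes the
  inner integrals over the truncated sections Riemann integrals.\<close>

lemma has_riemann_integral_cbox_finite_discontinuities:
  fixes k :: "real \<Rightarrow> real"
  assumes "finite D" and cont: "continuous_on ({c..d} - D) k"
    and bd: "\<And>x. x \<in> {c..d} \<Longrightarrow> \<bar>k x\<bar> \<le> B"
  shows "k integrable_on cbox c d" "has_riemann_integral_cbox k (integral (cbox c d) k) c d"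
proof -
  have approx: "\<exists>G h. continuous_on (cbox c d) G \<and> continuous_on (cbox c d) h \<and>
      (\<forall>x\<in>cbox c d. \<bar>k x - G x\<bar> \<le> h x) \<and> integral (cbox c d) h < e" if "e > 0" for e
  proof -
    \<comment> \<open>If \<open>{c..d}\<close> is empty, \<open>B\<close> may be negative, whereas
      Tietze asks for a nonnegative bound.\<close>
    define B' where "B' = max B 0"
    \<comment> \<open>Each point of \<open>D\<close> costs \<open>2 * B'\<close> times the integral
      of a tent, at most \<open>4 * B' * s\<close>. The added ones keep the denominator positive and
      the total strictly below \<open>e\<close>.\<close>
    define s where "s = e / (4 * (B' + 1) * (real (card D) + 1))"
    have B': "B' \<ge> 0" "\<And>x. x \<in> {c..d} \<Longrightarrow> \<bar>k x\<bar> \<le> B'" using bd by (auto simp: B'_def le_max_iff_disj)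
    have s: "s > 0" using \<open>e > 0\<close> B'(1) by (simp add: s_def add_nonneg_pos)
    define V where "V = (\<Union>t\<in>D. {t - s/2<..<t - s/2 + s})"
    have DV: "D \<subseteq> V" using s by (force simp: V_def)
    have "open V" by (auto simp: V_def)
    have "continuous_on ({c..d} - V) k"
      using cont DV continuous_on_subset by blast
    moreover have "closedin (top_of_set UNIV) ({c..d} - V)"
      using \<open>open V\<close> by auto
    ultimately obtain G where G: "continuous_on UNIV G" "\<And>x. x \<in> {c..d} - V \<Longrightarrow> G x = k x"
      "\<And>x. \<bar>G x\<bar> \<le> B'"
      using Tietze[of "{c..d} - V" k UNIV B'] B' by auto
    define h where "h = (\<lambda>x. \<Sum>t\<in>D. 2 * B' * tent (t - s/2) s x)"
    have "continuous_on (cbox c d) h"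
      unfolding h_def by (intro continuous_intros continuous_on_tent)
    moreover have "\<bar>k x - G x\<bar> \<le> h x" if x: "x \<in> cbox c d" for x
    proof (cases "x \<in> V")
      case True
      then obtain t where t: "t \<in> D" "x \<in> {t - s/2<..<t - s/2 + s}" by (auto simp: V_def)
      have "\<bar>k x - G x\<bar> \<le> 2 * B' * 1" using B'(2)[of x] G(3)[of x] x by auto
      also have "\<dots> \<le> 2 * B' * tent (t - s/2) s x"
        using indicator_le_tent[of "t - s/2" s x] t(2) B'(1) by (intro mult_left_mono) auto
      also have "\<dots> \<le> h x"
        unfolding h_def using t(1) \<open>finite D\<close> B'(1)
        by (intro member_le_sum) (auto simp: tent_nonneg)
      finally show ?thesis .
    next
      case False
      then have "\<bar>k x - G x\<bar> = 0" using G(2) x by auto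
      then show ?thesis using B'(1) by (auto simp: h_def intro!: sum_nonneg mult_nonneg_nonneg tent_nonneg)
    qed
    moreover have "integral (cbox c d) h < e"
    proof -
      have "integral (cbox c d) h = (\<Sum>t\<in>D. 2 * B' * integral (cbox c d) (tent (t - s/2) s))"
        unfolding h_def using \<open>finite D\<close>
        by (subst integral_sum)
          (auto intro!: integrable_continuous_interval continuous_intros continuous_on_tent)
      also have "\<dots> \<le> (\<Sum>t\<in>D. 2 * B' * (2 * s))"
        using B'(1) by (intro sum_mono mult_left_mono integral_tent_le s) auto
      also have "\<dots> = 4 * B' * real (card D) * s" by simp
      also have "\<dots> < 4 * (B' + 1) * (real (card D) + 1) * s"
        using s B'(1) by (intro mult_strict_right_mono) (auto simp: algebra_simps intro: add_pos_nonneg)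
      also have "\<dots> = e" using B'(1) by (simp add: s_def)
      finally show ?thesis .
    qed
    ultimately show ?thesis using continuous_on_subset[OF G(1)] by blast
  qed
  show "k integrable_on cbox c d" "has_riemann_integral_cbox k (integral (cbox c d) k) c d"
    using has_riemann_integral_cbox_approx[OF approx] by blast+
qed

section \<open>Functions continuous off a finite union of squares\<close>

text \<open>A point off the frontier lies either in the interior of \<Omega>, where continuity
  within \<Omega> is full continuity, or in the open complement, where the extension is zero
  nearby.\<close>

lemma continuous_on_extend_zero:
  fixes f :: "real \<times> real \<Rightarrow> real"
  assumes "closed \<Omega>" "open \<Delta>" "discontinuities \<Omega> f \<union> frontier \<Omega> \<subseteq> \<Delta>"
  shows "continuous_on (- \<Delta>) (\<lambda>z. if z \<in> \<Omega> then f z else 0)"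
proof (rule continuous_at_imp_continuous_on, rule ballI)
  let ?f = "\<lambda>z. if z \<in> \<Omega> then f z else 0"
  fix z assume "z \<in> - \<Delta>"
  then have z: "z \<notin> discontinuities \<Omega> f" "z \<notin> frontier \<Omega>" using assms(3) by auto
  show "isCont ?f z"
  proof (cases "z \<in> \<Omega>")
    case True
    with z(2) have i: "z \<in> interior \<Omega>" by (auto simp: frontier_def closure_def)
    have "continuous (at z within \<Omega>) f" using z(1) True by (auto simp: discontinuities_def)
    then have "isCont f z" by (simp only: at_within_interior[OF i])
    moreover have "\<forall>\<^sub>F y in nhds z. ?f y = f y"
      using i interior_subset unfolding eventually_nhds
      by (intro exI[of _ "interior \<Omega>"]) auto
    ultimately show ?thesis by (simp only: isCont_cong)
  next
    case False
    have "\<forall>\<^sub>F y in nhds z. ?f y = 0"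
      unfolding eventually_nhds using False assms(1) by (intro exI[of _ "- \<Omega>"]) auto
    then have "isCont ?f z \<longleftrightarrow> isCont (\<lambda>_. 0::real) z" by (rule isCont_cong)
    then show ?thesis by (simp only: continuous_const)
  qed
qed

section \<open>Sections and measure of finite unions of open squares\<close>

lemma open_squareE:
  assumes "open_square Q"
  obtains u v s where "s > 0" "Q = {u<..<u + s} \<times> {v<..<v + s}" "measure lborel Q = s * s"
proof -
  obtain u v s where s: "s > 0" and Q: "Q = {u<..<u + s} \<times> {v<..<v + s}"
    using assms unfolding open_square_def by blast
  have "Q = box (u, v) (u + s, v + s)"
    unfolding Q by (auto simp: box_def Basis_prod_def)
  then have "measure lborel Q = s * s"
    using s by (simp add: measure_lborel_box_eq Basis_prod_def prod.union_disjoint)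
  with s Q that show thesis by blast
qed

lemma open_open_square: "open_square Q \<Longrightarrow> open Q"
  by (auto simp: open_square_def intro: open_Times)

lemma section_Union: "{y. (x, y) \<in> \<Union>F} = (\<Union>Q\<in>F. {y. (x, y) \<in> Q})"
  by auto

lemma section_Times: "{y. (x, y) \<in> A \<times> B} = (if x \<in> A then B else {})"
  by auto

text \<open>Each square contributes an open interval or the empty set, hence at most two frontier
  points, and the frontier of a union lies in the union of the frontiers.\<close>

lemma finite_frontier_section:
  assumes "finite F" "\<forall>Q\<in>F. open_square Q"
  shows "finite (frontier {y. (x, y) \<in> \<Union>F})"
  using assms
proof (induction F)
  case (insert Q F)
  have "open_square Q" using insert.prems by simp
  then obtain u v s where "s > 0" "Q = {u<..<u + s} \<times> {v<..<v + s}"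
    unfolding open_square_def by blast
  then have "{y. (x, y) \<in> Q} = (if x \<in> {u<..<u + s} then {v<..<v + s} else {})"
    by (simp only: section_Times)
  moreover have "frontier {v<..<v + s} \<subseteq> {v, v + s}"
    using \<open>s > 0\<close> by (auto simp: frontier_def interior_open)
  ultimately have "finite (frontier {y. (x, y) \<in> Q})"
    by (auto intro: finite_subset)
  moreover have "{y. (x, y) \<in> \<Union>(insert Q F)} = {y. (x, y) \<in> Q} \<union> {y. (x, y) \<in> \<Union>F}"
    by auto
  ultimately show ?case
    using insert by (simp add: finite_subset[OF frontier_Un_subset])
qed auto

lemma open_section: "open D \<Longrightarrow> open {y. (x, y) \<in> D}"
  using open_vimage[of D "Pair x"] by (simp add: vimage_def continuous_on_Pair)

text \<open>The section of a square of side \<open>s\<close> has length \<open>s\<close> times the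
  indicator of its projection. Replacing that indicator by a tent makes the bound continuous in
  \<open>x\<close>, as the approximation criterion demands, and at most doubles the area
  \<open>s * s\<close>.\<close>

lemma squares_section_bound:
  assumes F: "finite F" "\<forall>Q\<in>F. open_square Q"
  obtains w where "continuous_on UNIV w"
    "\<And>x. {y. (x, y) \<in> \<Union>F} \<in> lmeasurable"
    "\<And>x. measure lebesgue {y. (x, y) \<in> \<Union>F} \<le> w x"
    "\<And>a b. integral (cbox a b) w \<le> 2 * (\<Sum>Q\<in>F. measure lborel Q)"
proof -
  have "\<forall>Q\<in>F. \<exists>u v s. s > 0 \<and> Q = {u<..<u + s} \<times> {v<..<v + s} \<and> measure lborel Q = s * s"
  proof
    fix Q assume "Q \<in> F"
    with F(2) have "open_square Q" by blast
    then show "\<exists>u v s. s > 0 \<and> Q = {u<..<u + s} \<times> {v<..<v + s} \<and> measure lborel Q = s * s"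
      by (rule open_squareE) blast
  qed
  then obtain u v s where Q: "\<And>Q. Q \<in> F \<Longrightarrow> s Q > 0"
    "\<And>Q. Q \<in> F \<Longrightarrow> Q = {u Q<..<u Q + s Q} \<times> {v Q<..<v Q + s Q}"
    "\<And>Q. Q \<in> F \<Longrightarrow> measure lborel Q = s Q * s Q"
    by metis
  have sec: "{y. (x, y) \<in> Q} = (if x \<in> {u Q<..<u Q + s Q} then {v Q<..<v Q + s Q} else {})"
    if "Q \<in> F" for Q x
    by (subst Q(2)[OF that]) (rule section_Times)
  have lm: "{y. (x, y) \<in> Q} \<in> lmeasurable" if "Q \<in> F" for Q x
    unfolding sec[OF that] by auto
  define w where "w = (\<lambda>x. \<Sum>Q\<in>F. s Q * tent (u Q) (s Q) x)"
  show thesis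
  proof (rule that[of w])
    show "continuous_on UNIV w" unfolding w_def by (intro continuous_intros continuous_on_tent)
    show "{y. (x, y) \<in> \<Union>F} \<in> lmeasurable" for x
      unfolding section_Union using F(1) lm by (intro fmeasurable.finite_UN) auto
    show "measure lebesgue {y. (x, y) \<in> \<Union>F} \<le> w x" for x
    proof -
      have "measure lebesgue {y. (x, y) \<in> \<Union>F} \<le> (\<Sum>Q\<in>F. measure lebesgue {y. (x, y) \<in> Q})"
        unfolding section_Union using F(1) lm by (intro measure_UNION_le) auto
      also have "\<dots> \<le> w x"
        unfolding w_def
      proof (rule sum_mono)
        fix Q assume "Q \<in> F"
        then have "measure lebesgue {y. (x, y) \<in> Q} = s Q * indicat_real {u Q<..<u Q + s Q} x"
          using Q(1)[OF \<open>Q \<in> F\<close>] by (simp add: sec)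
        also have "\<dots> \<le> s Q * tent (u Q) (s Q) x"
          using Q(1)[OF \<open>Q \<in> F\<close>] by (intro mult_left_mono indicator_le_tent) auto
        finally show "measure lebesgue {y. (x, y) \<in> Q} \<le> s Q * tent (u Q) (s Q) x" .
      qed
      finally show ?thesis .
    qed
    show "integral (cbox a b) w \<le> 2 * (\<Sum>Q\<in>F. measure lborel Q)" for a b
    proof -
      have "integral (cbox a b) w = (\<Sum>Q\<in>F. s Q * integral (cbox a b) (tent (u Q) (s Q)))"
        unfolding w_def using F(1)
        by (subst integral_sum)
          (auto intro!: integrable_continuous_interval continuous_intros continuous_on_tent)
      also have "\<dots> \<le> (\<Sum>Q\<in>F. s Q * (2 * s Q))"
        using Q(1) by (intro sum_mono mult_left_mono integral_tent_le) (auto intro: less_imp_le)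
      also have "\<dots> = 2 * (\<Sum>Q\<in>F. measure lborel Q)"
        using Q(3) by (simp add: sum_distrib_left mult_ac)
      finally show ?thesis .
    qed
  qed
qed

lemma squares_measure_bound:
  assumes F: "finite F" "\<forall>Q\<in>F. open_square Q"
  shows "\<Union>F \<in> lmeasurable" "measure lebesgue (\<Union>F) \<le> (\<Sum>Q\<in>F. measure lborel Q)"
proof -
  have lm: "Q \<in> lmeasurable" if "Q \<in> F" for Q
  proof -
    have Q: "open_square Q" using F(2) that by blast
    then obtain u v s where "Q = {u<..<u + s} \<times> {v<..<v + s}"
      unfolding open_square_def by blast
    then have "bounded Q" by (simp add: bounded_Times)
    then show ?thesis using open_open_square[OF Q] by (rule lmeasurable_open)
  qed
  then show "\<Union>F \<in> lmeasurable"
    using F(1) fmeasurable.finite_Union by blast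
  have "measure lebesgue (\<Union>F) \<le> (\<Sum>Q\<in>F. measure lebesgue Q)"
    using measure_UNION_le[of F "\<lambda>Q. Q" lebesgue] F(1) lm by auto
  also have "\<dots> = (\<Sum>Q\<in>F. measure lborel Q)"
  proof (rule sum.cong[OF refl])
    fix Q assume "Q \<in> F"
    then have "open Q" using F(2) open_open_square by blast
    then have "Q \<in> sets lborel" by simp
    then show "measure lebesgue Q = measure lborel Q" by (rule measure_completion)
  qed
  finally show "measure lebesgue (\<Union>F) \<le> (\<Sum>Q\<in>F. measure lborel Q)" .
qed

text \<open>The difference is dominated by \<open>B\<close> times the indicator of \<open>S\<close>.
  It serves both on vertical sections and in the plane, each time with
  \<open>B = 2 * M\<close>.\<close>

lemma integral_diff_bound_indicator:
  fixes p q :: "'a::euclidean_space \<Rightarrow> real"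
  assumes p: "p integrable_on cbox a b" and q: "q integrable_on cbox a b"
    and S: "S \<in> lmeasurable" and "B \<ge> 0"
    and le: "\<And>x. x \<in> cbox a b \<Longrightarrow> \<bar>p x - q x\<bar> \<le> B"
    and eq: "\<And>x. x \<in> cbox a b \<Longrightarrow> x \<notin> S \<Longrightarrow> p x = q x"
  shows "\<bar>integral (cbox a b) p - integral (cbox a b) q\<bar> \<le> B * measure lebesgue S"
proof -
  have "(\<lambda>x. B * indicat_real S x) integrable_on cbox a b"
    using integrable_cmul[OF integral_indicator_cbox_le(1)[OF S], of B] by simp
  then have "norm (integral (cbox a b) (\<lambda>x. p x - q x)) \<le>
      integral (cbox a b) (\<lambda>x. B * indicat_real S x)"
  proof (rule integral_norm_bound_integral[OF integrable_diff[OF p q]])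
    show "norm (p x - q x) \<le> B * indicat_real S x" if "x \<in> cbox a b" for x
      using le[OF that] eq[OF that] by (cases "x \<in> S") auto
  qed
  also have "\<dots> \<le> B * measure lebesgue S"
    using integral_indicator_cbox_le(2)[OF S] \<open>B \<ge> 0\<close> by (auto intro: mult_left_mono)
  finally show ?thesis by (simp add: integral_diff p q)
qed

text \<open>The complement of the frontier is the union of the open sets \<open>U\<close> and
  \<open>- closure U\<close>, and the function is continuous on each.\<close>

lemma continuous_on_cut_off:
  fixes h :: "'a::topological_space \<Rightarrow> real"
  assumes "open U" "continuous_on UNIV h"
  shows "continuous_on (- frontier U) (\<lambda>y. if y \<in> U then 0 else h y)"
proof -
  let ?k = "\<lambda>y. if y \<in> U then 0 else h y"
  have "continuous_on U ?k"
    by (rule continuous_on_eq[OF continuous_on_const]) auto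
  moreover have "continuous_on (- closure U) ?k"
    by (rule continuous_on_eq[OF continuous_on_subset[OF assms(2)]]) (use closure_subset in auto)
  ultimately have "continuous_on (U \<union> - closure U) ?k"
    using assms(1) by (intro continuous_on_open_Un) auto
  moreover have "U \<union> - closure U = - frontier U"
    using assms(1) closure_subset[of U] by (auto simp: frontier_def interior_open)
  ultimately show ?thesis by simp
qed

section \<open>The double integral as a repeated integral\<close>

theorem theorem5:
  fixes a b c d :: real
    and \<Omega> :: "(real \<times> real) set"
    and f :: "real \<times> real \<Rightarrow> real"
    and \<epsilon> :: "nat \<Rightarrow> real"
    and F :: "nat \<Rightarrow> (real \<times> real) set set"
    and \<Delta> :: "nat \<Rightarrow> (real \<times> real) set"
  assumes "a < b" and "c < d"
    and "closed_jordan_domain \<Omega>"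
    and "\<Omega> \<subseteq> {a<..<b} \<times> {c<..<d}"
    and "f riemann_integrable_on \<Omega>"
    and "zero_jordan_measure (discontinuities \<Omega> f)"
    and "closed (discontinuities \<Omega> f)"
    and "\<And>n. \<epsilon> n > 0" and "\<And>n. \<epsilon> (Suc n) < \<epsilon> n" and "\<epsilon> \<longlonglongrightarrow> 0"
    and "\<And>n. admissible_squares \<Omega> f (\<epsilon> n) (F n)"
    and "\<And>n. \<Delta> n = \<Union>(F n)"
    and "\<And>n. \<Delta> (Suc n) \<subseteq> \<Delta> n"
  shows "\<exists>g. (\<forall>x\<in>{a..b}. has_improper_integral_along (\<lambda>y. f (x, y))
                 (\<lambda>n. section_minus \<Omega> (\<Delta> n) x) (\<Union>n. section_minus \<Omega> (\<Delta> n) x) (g x)) \<and>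
             g riemann_integrable_on {a..b} \<and>
             riemann_integral \<Omega> f = riemann_integral {a..b} g"
proof -
  note ab = \<open>a < b\<close> and cd = \<open>c < d\<close> and \<Omega>sub = assms(4) and \<epsilon>0 = \<open>\<epsilon> \<longlonglongrightarrow> 0\<close> and \<Delta> = assms(12)
  have "closed \<Omega>" using assms(3) by (simp add: closed_jordan_domain_def)
  have F: "finite (F n)" "\<forall>Q\<in>F n. open_square Q" "(\<Sum>Q\<in>F n. measure lborel Q) < \<epsilon> n"
    "discontinuities \<Omega> f \<union> frontier \<Omega> \<subseteq> \<Delta> n" for n
    using assms(11)[of n] unfolding admissible_squares_def \<Delta> by auto
  have open\<Delta>: "open (\<Delta> n)" for n
    unfolding \<Delta> using F(2) open_open_square by blast
  have dec: "\<Delta> m \<subseteq> \<Delta> n" if "n \<le> m" for m n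
    using lift_Suc_antimono_le[of \<Delta>] assms(13) that by blast
  obtain M where M: "M \<ge> 0" "\<And>z. z \<in> \<Omega> \<Longrightarrow> \<bar>f z\<bar> \<le> M"
    using riemann_integrable_imp_bounded[OF assms(5)] unfolding bounded_pos
    by (auto intro: less_imp_le)
  define f0 where "f0 z = (if z \<in> \<Omega> then f z else 0)" for z
  have f0_le: "\<bar>f0 z\<bar> \<le> M" for z using M by (simp add: f0_def)
  have "\<exists>\<phi>. continuous_on UNIV \<phi> \<and> (\<forall>z. z \<notin> \<Delta> n \<longrightarrow> \<phi> z = f0 z) \<and> (\<forall>z. \<bar>\<phi> z\<bar> \<le> M)" for n
  proof -
    have "continuous_on (- \<Delta> n) f0"
      using continuous_on_extend_zero[OF \<open>closed \<Omega>\<close> open\<Delta> F(4)] by (simp add: f0_def[abs_def])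
    moreover have "closedin (top_of_set UNIV) (- \<Delta> n)" using open\<Delta> by auto
    ultimately show ?thesis
      using Tietze[of "- \<Delta> n" f0 UNIV M] M(1) f0_le by (metis ComplI UNIV_I real_norm_def)
  qed
  then obtain \<phi> where \<phi>: "\<And>n. continuous_on UNIV (\<phi> n)" "\<And>n z. z \<notin> \<Delta> n \<Longrightarrow> \<phi> n z = f0 z"
    "\<And>n z. \<bar>\<phi> n z\<bar> \<le> M"
    by metis
  have \<phi>sec: "continuous_on A (\<lambda>y. \<phi> n (x, y))" for A n x
    by (rule continuous_on_compose2[OF \<phi>(1)]) (auto intro!: continuous_intros)
  define G where "G n x = integral (cbox c d) (\<lambda>y. \<phi> n (x, y))" for n x
  have contG: "continuous_on (cbox a b) (G n)" for n
    unfolding G_def using continuous_on_subset[OF \<phi>(1)]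
    by (intro integral_continuous_on_param) (auto simp: case_prod_eta)
  have "\<exists>w. continuous_on UNIV w \<and> (\<forall>x. {y. (x, y) \<in> \<Delta> n} \<in> lmeasurable) \<and>
      (\<forall>x. measure lebesgue {y. (x, y) \<in> \<Delta> n} \<le> w x) \<and> integral (cbox a b) w \<le> 2 * \<epsilon> n" for n
  proof -
    obtain w where "continuous_on UNIV w" "\<And>x. {y. (x, y) \<in> \<Delta> n} \<in> lmeasurable"
      "\<And>x. measure lebesgue {y. (x, y) \<in> \<Delta> n} \<le> w x"
      "integral (cbox a b) w \<le> 2 * (\<Sum>Q\<in>F n. measure lborel Q)"
      using squares_section_bound[OF F(1,2)[of n]] unfolding \<Delta> by metis
    then show ?thesis using F(3)[of n] by (intro exI[of _ w]) auto
  qed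
  then obtain w where w: "\<And>n. continuous_on UNIV (w n)"
    "\<And>n x. {y. (x, y) \<in> \<Delta> n} \<in> lmeasurable"
    "\<And>n x. measure lebesgue {y. (x, y) \<in> \<Delta> n} \<le> w n x"
    "\<And>n. integral (cbox a b) (w n) \<le> 2 * \<epsilon> n"
    by metis

  \<comment> \<open>The truncated inner integrals and their limit\<close>
  define T where "T x n = section_minus \<Omega> (\<Delta> n) x" for x n
  have T: "y \<in> T x n \<longleftrightarrow> (x, y) \<in> \<Omega> \<and> (x, y) \<notin> \<Delta> n" for x y n
    by (auto simp: T_def section_minus_def)
  have Tcd: "T x n \<subseteq> cbox c d" for x n using \<Omega>sub by (force simp: T)
  define k where "k x n y = (if y \<in> T x n then f (x, y) else 0)" for x n y
  have k_le: "\<bar>k x n y\<bar> \<le> M" for x n y using M by (simp add: k_def T)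
  \<comment> \<open>Because the coverings are nested, a single \<open>\<phi> n\<close> serves all
    later truncations, so the resulting bound is uniform in \<open>m\<close> and survives the
    limit.\<close>
  have k_eq: "k x m y = \<phi> n (x, y)" if "n \<le> m" "(x, y) \<notin> \<Delta> n" for x m n y
    using that dec[OF \<open>n \<le> m\<close>] \<phi>(2)[OF that(2)] by (auto simp: k_def T f0_def)
  have k: "k x n integrable_on cbox c d"
    "has_riemann_integral_cbox (k x n) (integral (cbox c d) (k x n)) c d" for x n
  proof -
    let ?U = "{y. (x, y) \<in> \<Delta> n}"
    \<comment> \<open>On the section of \<open>\<Delta> n\<close> both sides are zero; elsewhere
      \<open>\<phi> n\<close> equals \<open>f0\<close>, which already vanishes outside
      \<Omega>.\<close>
    have "k x n = (\<lambda>y. if y \<in> ?U then 0 else \<phi> n (x, y))"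
      using \<phi>(2) by (auto simp: k_def T f0_def)
    then have "continuous_on (- frontier ?U) (k x n)"
      using continuous_on_cut_off[OF open_section[OF open\<Delta>] \<phi>sec] by simp
    then have cont: "continuous_on ({c..d} - frontier ?U) (k x n)"
      by (rule continuous_on_subset) auto
    have fin: "finite (frontier ?U)"
      unfolding \<Delta> by (rule finite_frontier_section[OF F(1,2)])
    show "k x n integrable_on cbox c d"
      "has_riemann_integral_cbox (k x n) (integral (cbox c d) (k x n)) c d"
      by (rule has_riemann_integral_cbox_finite_discontinuities[OF fin cont k_le])+
  qed
  have kR: "((\<lambda>y. f (x, y)) has_riemann_integral integral (cbox c d) (k x n)) (T x n)" for x n
    unfolding has_riemann_integral_def
    using k(2)[of x n] Tcd cd by (intro exI[of _ c] exI[of _ d]) (auto simp: k_def[abs_def])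
  have incT: "incseq (T x)" for x
    using dec by (fastforce simp: incseq_def T)
  \<comment> \<open>The limit is written as a gauge integral over the whole section; dominated
    convergence with the constant bound \<open>M\<close> identifies it with the improper
    integral.\<close>
  define g where "g x = integral (cbox c d) (\<lambda>y. if y \<in> (\<Union>n. T x n) then f (x, y) else 0)" for x
  have lim: "(\<lambda>n. integral (cbox c d) (k x n)) \<longlonglongrightarrow> g x" for x
    unfolding g_def
  proof (rule dominated_convergence)
    show "(\<lambda>n. k x n y) \<longlonglongrightarrow> (if y \<in> (\<Union>n. T x n) then f (x, y) else 0)" for y
    proof (cases "y \<in> (\<Union>n. T x n)")
      case True
      then obtain N where "y \<in> T x N" by auto
      then have "\<forall>\<^sub>F n in sequentially. k x n y = f (x, y)"
        using incseqD[OF incT[of x]] by (intro eventually_sequentiallyI[of N]) (auto simp: k_def)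
      then show ?thesis using True by (simp add: tendsto_eventually)
    qed (simp add: k_def)
    show "(\<lambda>y. M) integrable_on cbox c d" by (rule integrable_const)
  qed (use k(1) k_le in auto)
  have gG: "\<bar>g x - G n x\<bar> \<le> 2 * M * w n x" for n x
  proof -
    have "\<bar>integral (cbox c d) (k x m) - G n x\<bar> \<le> 2 * M * w n x" if "n \<le> m" for m
    proof -
      have "\<bar>k x m y - \<phi> n (x, y)\<bar> \<le> 2 * M" for y
        using k_le[of x m y] \<phi>(3)[of n "(x, y)"] by linarith
      then have "\<bar>integral (cbox c d) (k x m) - G n x\<bar> \<le>
          2 * M * measure lebesgue {y. (x, y) \<in> \<Delta> n}"
        unfolding G_def using k_eq[OF that] M(1)
        by (intro integral_diff_bound_indicator k(1) integrable_continuous \<phi>sec w(2)) auto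
      also have "\<dots> \<le> 2 * M * w n x" using M(1) by (intro mult_left_mono w(3)) auto
      finally show ?thesis .
    qed
    moreover have "(\<lambda>m. \<bar>integral (cbox c d) (k x m) - G n x\<bar>) \<longlonglongrightarrow> \<bar>g x - G n x\<bar>"
      by (intro tendsto_intros lim)
    ultimately show ?thesis by (intro LIMSEQ_le_const2) auto
  qed

  \<comment> \<open>Riemann integrability of the limit and equality of the integrals\<close>
  have int_w: "integral (cbox a b) (\<lambda>x. 2 * M * w n x) \<le> 4 * M * \<epsilon> n" for n
    using mult_left_mono[OF w(4)[of n], of "2 * M"] M(1) by simp
  have contw: "continuous_on (cbox a b) (\<lambda>x. 2 * M * w n x)" for n
    using continuous_on_subset[OF w(1)] by (intro continuous_intros) auto
  have "\<exists>G h. continuous_on (cbox a b) G \<and> continuous_on (cbox a b) h \<and>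
      (\<forall>x\<in>cbox a b. \<bar>g x - G x\<bar> \<le> h x) \<and> integral (cbox a b) h < e" if "e > 0" for e
  proof -
    have "(\<lambda>n. 4 * M * \<epsilon> n) \<longlonglongrightarrow> 4 * M * 0" by (intro tendsto_intros \<epsilon>0)
    then have "\<forall>\<^sub>F n in sequentially. 4 * M * \<epsilon> n < e"
      using order_tendstoD(2) that by force
    then obtain n where "4 * M * \<epsilon> n < e" by (auto simp: eventually_sequentially)
    then show ?thesis using contG contw gG int_w[of n] by (meson order_le_less_trans)
  qed
  note g = has_riemann_integral_cbox_approx[OF this]
  have gR: "(g has_riemann_integral integral (cbox a b) g) {a..b}"
    unfolding has_riemann_integral_def
  proof (intro exI conjI)
    show "has_riemann_integral_cbox (\<lambda>x. if x \<in> {a..b} then g x else 0) (integral (cbox a b) g) a b"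
      by (rule has_riemann_integral_cbox_eq[OF g(2)]) auto
  qed (use ab in auto)
  obtain I where I: "(f has_riemann_integral I) \<Omega>"
    using assms(5) by (auto simp: riemann_integrable_on_def)
  have "I = integral (cbox a b) g"
  proof -
    let ?R = "cbox (a, c) (b, d)"
    \<comment> \<open>The box witnessing integrability of \<open>f\<close> need not be
      \<open>?R\<close>; passing to the gauge integral removes the dependence on it.\<close>
    have "(f has_integral I) \<Omega>" using I by (rule has_riemann_integral_imp_has_integral)
    moreover have "\<Omega> \<subseteq> ?R" using \<Omega>sub by (force simp: cbox_Pair_eq)
    ultimately have f0I: "(f0 has_integral I) ?R"
      by (simp add: has_integral_restrict f0_def[abs_def])
    \<comment> \<open>Replacing \<open>f0\<close> by \<open>\<phi> n\<close> in the plane costs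
      \<open>2 * M * \<epsilon> n\<close>, and replacing \<open>G n\<close> by \<open>g\<close> on
      the line costs \<open>4 * M * \<epsilon> n\<close>.\<close>
    have "\<bar>I - integral (cbox a b) g\<bar> \<le> 6 * M * \<epsilon> n" for n
    proof -
      have "\<bar>f0 z - \<phi> n z\<bar> \<le> 2 * M" for z using f0_le[of z] \<phi>(3)[of n z] by linarith
      then have "\<bar>integral ?R f0 - integral ?R (\<phi> n)\<bar> \<le> 2 * M * measure lebesgue (\<Delta> n)"
        using \<phi>(2)[of _ n] M(1) squares_measure_bound(1)[OF F(1,2)[of n]]
        by (intro integral_diff_bound_indicator has_integral_integrable[OF f0I]
            integrable_continuous continuous_on_subset[OF \<phi>(1)[of n]]) (auto simp: \<Delta>)
      also have "\<dots> \<le> 2 * M * \<epsilon> n"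
        using squares_measure_bound(2)[OF F(1,2)[of n]] F(3)[of n] M(1) unfolding \<Delta>
        by (intro mult_left_mono) auto
      finally have 1: "\<bar>I - integral ?R (\<phi> n)\<bar> \<le> 2 * M * \<epsilon> n"
        using f0I by (simp add: integral_unique)
      have 2: "integral ?R (\<phi> n) = integral (cbox a b) (G n)"
        unfolding G_def using continuous_on_subset[OF \<phi>(1)[of n]] by (intro integral_prod_continuous) auto
      have "norm (integral (cbox a b) (\<lambda>x. g x - G n x)) \<le> integral (cbox a b) (\<lambda>x. 2 * M * w n x)"
        using gG by (intro integral_norm_bound_integral integrable_diff g(1)
            integrable_continuous contG contw) auto
      then have "\<bar>integral (cbox a b) (\<lambda>x. g x - G n x)\<bar> \<le> integral (cbox a b) (\<lambda>x. 2 * M * w n x)"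
        by (simp only: real_norm_def)
      then have "\<bar>integral (cbox a b) g - integral (cbox a b) (G n)\<bar> \<le> 4 * M * \<epsilon> n"
        using int_w[of n] integral_diff[OF g(1) integrable_continuous[OF contG[of n]]] by linarith
      with 1 2 show ?thesis by linarith
    qed
    moreover have "(\<lambda>n. 6 * M * \<epsilon> n) \<longlonglongrightarrow> 6 * M * 0" by (intro tendsto_intros \<epsilon>0)
    ultimately have "\<bar>I - integral (cbox a b) g\<bar> \<le> 6 * M * 0"
      by (intro LIMSEQ_le_const) auto
    then show ?thesis by simp
  qed
  then have "riemann_integral \<Omega> f = riemann_integral {a..b} g"
    using riemann_integral_unique[OF I] riemann_integral_unique[OF gR] by simp
  moreover have "has_improper_integral_along (\<lambda>y. f (x, y)) (T x) (\<Union>n. T x n) (g x)" for x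
    using incT kR lim riemann_integral_unique[OF kR]
    unfolding has_improper_integral_along_def riemann_integrable_on_def by auto
  ultimately show ?thesis
    using gR unfolding riemann_integrable_on_def T_def by blast
qed

end
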